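(* Let $Q$ be a real $m\times n$ matrix with $Q^TQ=I_n$, leverage scores $\ell_j=\|e_j^TQ\|_2^2$, $1\le j\le m$, and coherence $\mu=\max_{1\le j\le m}\ell_j$. Label the leverage scores in non-increasing order, $\mu=\ell_{[1]}\ge\cdots\ge\ell_{[m]}$, and set $$t\equiv\lfloor 1/\mu\rfloor,\qquad \tau\equiv\mu\sum_{j=1}^t\ell_{[j]}+(1-t\,\mu)\,\ell_{[t+1]}.$$ Let $0<\epsilon<1$ and $0<\delta<1$. Then $$\tfrac{2}{3}\,m\,(3\tau+\epsilon\mu)\,\frac{\ln(2n/\delta)}{\epsilon^2}\le 3m\mu\,\frac{\ln(2n/\delta)}{\epsilon^2}.$$
   Context: Here $e_1,\dots,e_m$ are the canonical (column) basis vectors of $\mathbb{R}^m$ and $\|\cdot\|_2$ is the Euclidean two-norm. If $t=m$ (which forces $1-t\mu=0$), the term $(1-t\mu)\,\ell_{[t+1]}$ is interpreted as $0$. *)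

theory Defs
  imports "HOL-Analysis.Analysis" "HOL-Library.Multiset"
begin

definition leverage_score :: "real ^ 'n ^ 'm \<Rightarrow> 'm \<Rightarrow> real" where
  "leverage_score Q j = (norm (axis j 1 v* Q))\<^sup>2"

definition coherence :: "real ^ 'n ^ 'm \<Rightarrow> real" where
  "coherence Q = Max (range (leverage_score Q))"

text \<open>The leverage scores, with multiplicity, in non-increasing order. The index \<open>k\<close> of
  \<open>sorted_leverage_score\<close> is 1-based and is meaningful for \<open>1 \<le> k \<le> m\<close> only.\<close>

definition sorted_leverage_scores :: "real ^ 'n ^ 'm \<Rightarrow> real list" where
  "sorted_leverage_scores Q =
     rev (sorted_list_of_multiset (image_mset (leverage_score Q) (mset_set UNIV)))"

definition sorted_leverage_score :: "real ^ 'n ^ 'm \<Rightarrow> nat \<Rightarrow> real" where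
  "sorted_leverage_score Q k = sorted_leverage_scores Q ! (k - 1)"

definition lev_t :: "real ^ 'n ^ 'm \<Rightarrow> nat" where
  "lev_t Q = nat \<lfloor>1 / coherence Q\<rfloor>"

text \<open>There is no score with index \<open>t + 1\<close> if \<open>t = m\<close>; the corresponding term is then zero.\<close>

definition lev_tau :: "real ^ 'n ^ 'm \<Rightarrow> real" where
  "lev_tau (Q :: real ^ 'n ^ 'm) =
     coherence Q * (\<Sum>j = 1..lev_t Q. sorted_leverage_score Q j) +
     (if lev_t Q = CARD('m) then 0
      else (1 - real (lev_t Q) * coherence Q) * sorted_leverage_score Q (lev_t Q + 1))"

end

theory Submission
  imports Defs
begin

text \<open>Since \<open>t \<mu> \<le> 1\<close> and no score exceeds \<open>\<mu>\<close>, the number \<open>\<tau>\<close> is a sum of scores with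
  nonnegative weights of total \<open>1\<close>, so \<open>\<tau> \<le> \<mu>\<close>; the claim is then \<open>2 + 2\<epsilon>/3 \<le> 3\<close>.
  The scores in \<open>\<tau>\<close> exist because \<open>t \<le> m\<close>: a column of \<open>Q\<close> has norm \<open>1\<close>, so \<open>1 \<le> m \<mu>\<close>.\<close>

lemma leverage_score_nonneg: "0 \<le> leverage_score Q j"
  by (simp add: leverage_score_def)

lemma leverage_score_le_coherence: "leverage_score Q j \<le> coherence Q"
  by (simp add: coherence_def)

lemma coherence_nonneg: "0 \<le> coherence Q"
  using leverage_score_nonneg leverage_score_le_coherence by (rule order_trans)

text \<open>The vector \<open>axis j 1 v* Q\<close> is row j of Q, and no component of a vector
  exceeds its norm.\<close>

lemma entry_square_le_leverage_score: "(Q $ j $ k)\<^sup>2 \<le> leverage_score Q j"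
proof -
  have "(axis j 1 v* Q) $ k = Q $ j $ k"
    by (simp add: vector_matrix_mult_def axis_def if_distrib[of "\<lambda>x. x * _"] cong: if_cong)
  then have "\<bar>Q $ j $ k\<bar> \<le> norm (axis j 1 v* Q)"
    by (metis component_le_norm_cart)
  then show ?thesis
    unfolding leverage_score_def by (metis abs_ge_zero power2_abs power_mono)
qed

text \<open>A diagonal entry of the Gram matrix is the squared norm of a column, a sum of m squared
  entries, each at most the score of its row.\<close>

lemma one_le_card_mult_coherence:
  fixes Q :: "real ^ 'n ^ 'm"
  assumes "transpose Q ** Q = mat 1"
  shows "1 \<le> real CARD('m) * coherence Q"
proof -
  fix k :: 'n
  have "1 = (transpose Q ** Q) $ k $ k"
    by (simp add: assms mat_def)
  also have "\<dots> = (\<Sum>j\<in>UNIV. (Q $ j $ k)\<^sup>2)"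
    by (simp add: matrix_matrix_mult_def transpose_def power2_eq_square)
  also have "\<dots> \<le> (\<Sum>j\<in>(UNIV :: 'm set). coherence Q)"
    by (intro sum_mono order_trans[OF entry_square_le_leverage_score leverage_score_le_coherence])
  finally show ?thesis by simp
qed

lemma lev_t_le_card:
  fixes Q :: "real ^ 'n ^ 'm"
  assumes "transpose Q ** Q = mat 1"
  shows "lev_t Q \<le> CARD('m)"
proof -
  \<comment> \<open>If the coherence were 0, the previous bound would read 1 \<le> 0.\<close>
  have "0 < coherence Q"
    using one_le_card_mult_coherence[OF assms] coherence_nonneg[of Q]
    by (cases "coherence Q = 0") auto
  then have "1 / coherence Q \<le> real CARD('m)"
    using one_le_card_mult_coherence[OF assms] by (simp add: divide_le_eq)
  then have "\<lfloor>1 / coherence Q\<rfloor> \<le> int CARD('m)"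
    using floor_mono by fastforce
  then show ?thesis by (simp add: lev_t_def)
qed

text \<open>This makes the weight of the last term of \<tau> nonnegative. For coherence 0 the
  product is 0; otherwise the floor is at most 1 / \<mu>.\<close>

lemma lev_t_mult_coherence_le_one: "real (lev_t Q) * coherence Q \<le> 1"
proof (cases "coherence Q = 0")
  case False
  then have pos: "0 < coherence Q"
    using coherence_nonneg[of Q] by simp
  then have "real (lev_t Q) \<le> 1 / coherence Q"
    unfolding lev_t_def by (intro of_nat_floor) simp
  then show ?thesis
    using pos by (simp add: le_divide_eq)
qed simp

lemma sorted_leverage_score_le_coherence:
  fixes Q :: "real ^ 'n ^ 'm"
  assumes "1 \<le> k" and "k \<le> CARD('m)"
  shows "sorted_leverage_score Q k \<le> coherence Q"
proof -
  let ?xs = "sorted_leverage_scores Q"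
  have "mset ?xs = image_mset (leverage_score Q) (mset_set UNIV)"
    by (simp add: sorted_leverage_scores_def)
  then have "length ?xs = CARD('m)" and set: "set ?xs = range (leverage_score Q)"
    by (metis size_mset size_image_mset size_mset_set,
        metis set_mset_mset set_image_mset finite_set_mset_mset_set finite)
  \<comment> \<open>The bounds on k place the 0-based index \<open>k - 1\<close> inside the list, so
    the entry is a genuine leverage score.\<close>
  then have "?xs ! (k - 1) \<in> set ?xs"
    using assms by (intro nth_mem) linarith
  then show ?thesis
    unfolding sorted_leverage_score_def set using leverage_score_le_coherence by auto
qed

lemma lev_tau_le_coherence:
  fixes Q :: "real ^ 'n ^ 'm"
  assumes "transpose Q ** Q = mat 1"
  shows "lev_tau Q \<le> coherence Q"
proof -
  let ?\<mu> = "coherence Q" and ?t = "lev_t Q"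
  have "(\<Sum>j = 1..?t. sorted_leverage_score Q j) \<le> (\<Sum>j = 1..?t. ?\<mu>)"
    using lev_t_le_card[OF assms] by (intro sum_mono sorted_leverage_score_le_coherence) auto
  then have "?\<mu> * (\<Sum>j = 1..?t. sorted_leverage_score Q j) \<le> ?\<mu> * (real ?t * ?\<mu>)"
    by (intro mult_left_mono coherence_nonneg) simp
  \<comment> \<open>If t = m, the left side is 0 and the right side is a product of nonnegative
    factors. Otherwise t + 1 \<le> m, so the score bound applies.\<close>
  moreover have "(if ?t = CARD('m) then 0
      else (1 - real ?t * ?\<mu>) * sorted_leverage_score Q (?t + 1)) \<le> (1 - real ?t * ?\<mu>) * ?\<mu>"
    using lev_t_le_card[OF assms] lev_t_mult_coherence_le_one[of Q] coherence_nonneg[of Q]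
    by (auto intro!: mult_left_mono mult_nonneg_nonneg sorted_leverage_score_le_coherence)
  \<comment> \<open>The two bounds add up to \<mu> (t \<mu>) + (1 - t \<mu>) \<mu> = \<mu>.\<close>
  ultimately show ?thesis
    unfolding lev_tau_def by (simp add: algebra_simps)
qed

theorem corollary5p7:
  fixes Q :: "real ^ 'n ^ 'm" and \<epsilon> \<delta> :: real
  assumes "transpose Q ** Q = mat 1"
    and "0 < \<epsilon>" and "\<epsilon> < 1"
    and "0 < \<delta>" and "\<delta> < 1"
  shows "2 / 3 * real CARD('m) * (3 * lev_tau Q + \<epsilon> * coherence Q)
           * (ln (2 * real CARD('n) / \<delta>) / \<epsilon>\<^sup>2)
         \<le> 3 * real CARD('m) * coherence Q * (ln (2 * real CARD('n) / \<delta>) / \<epsilon>\<^sup>2)"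
proof (rule mult_right_mono)
  have "\<epsilon> * coherence Q \<le> coherence Q"
    using assms coherence_nonneg[of Q] by (simp add: mult_left_le_one_le)
  then have "2 / 3 * (3 * lev_tau Q + \<epsilon> * coherence Q) \<le> 3 * coherence Q"
    using lev_tau_le_coherence[OF assms(1)] coherence_nonneg[of Q] by argo
  from mult_left_mono[OF this, of "real CARD('m)"]
  show "2 / 3 * real CARD('m) * (3 * lev_tau Q + \<epsilon> * coherence Q)
      \<le> 3 * real CARD('m) * coherence Q"
    by (simp add: mult_ac)
  \<comment> \<open>The common factor is nonnegative: n \<ge> 1 and \<delta> < 1 make the argument
    of \<open>ln\<close> at least 1.\<close>
  have "1 \<le> real CARD('n)"
    using zero_less_card_finite[where 'a = 'n] by linarith
  then have "\<delta> \<le> 2 * real CARD('n)"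
    using assms by linarith
  then have "1 \<le> 2 * real CARD('n) / \<delta>"
    using assms by (simp add: le_divide_eq)
  then show "0 \<le> ln (2 * real CARD('n) / \<delta>) / \<epsilon>\<^sup>2"
    by (intro divide_nonneg_nonneg ln_ge_zero) simp_all
qed

end
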